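(* Let odd and even vertices of the diamond $D_n$ be closed with respective probabilities $p>0$ and $q=0$, independently for different vertices, and consider a game of Trap on the open subgraph of $D_n$. For every constant $c>0$, if $n<c/(p\log p^{-1})$, then, with high probability as $p\to0$, from every initial vertex in $D_n$, Odin wins.
   Context: A vertex of $\mathbb{Z}^2$ is odd or even according to the parity of the sum of its coordinates. Adjacency in $\mathbb{Z}^2$: $u\sim v$ iff $\|u-v\|_1=1$. For an integer $n>0$, the diamond $D_n$ is the subgraph of $\mathbb{Z}^2$ induced by $\{u\in\mathbb{Z}^2:\|u\|_1<2n\}$. "With high probability" means with probability tending to $1$. Trap: a token starts at an initial vertex of a graph; two players alternately move it along an incident edge to a vertex never visited before (the initial vertex counts as visited). A player who has no possible move loses and the other wins. A player "wins" from an initial vertex if she/he has a winning strategy, i.e. a strategy that results in a win whatever the opponent does. Vertices that are not closed are open; since $q=0$, all even vertices are open. Trap on the open subgraph of $D_n$ means that moves to closed vertices and moves out of $D_n$ are forbidden. For convenience, the game is declared a first-player win if the initial vertex is closed. Odin is the player who moves from even vertices to odd vertices; Eve is the player who moves from odd vertices to even vertices. Thus if the initial vertex is even Odin moves first, and if it is odd Eve moves first.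
   Formalization: The claim is for every open initial vertex in D_n; closed initial vertices are excluded, because by the stated convention a closed odd start counts as a win for Eve, and such vertices exist with high probability when n is near c/(p log(1/p)). *)

theory Defs
  imports "HOL-Probability.Probability"
begin

section \<open>The diamond in the square lattice\<close>

type_synonym vertex = "int \<times> int"

definition l1_norm :: "vertex \<Rightarrow> int" where
  "l1_norm u = \<bar>fst u\<bar> + \<bar>snd u\<bar>"

definition adjacent :: "vertex \<Rightarrow> vertex \<Rightarrow> bool" where
  "adjacent u v \<longleftrightarrow> l1_norm (u - v) = 1"

definition even_vertex :: "vertex \<Rightarrow> bool" where
  "even_vertex u \<longleftrightarrow> even (fst u + snd u)"

definition diamond :: "nat \<Rightarrow> vertex set" where
  "diamond n = {u. l1_norm u < 2 * int n}"

lemma finite_diamond: "finite (diamond n)"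
proof (rule finite_subset)
  show "diamond n \<subseteq> {- 2 * int n..2 * int n} \<times> {- 2 * int n..2 * int n}"
    by (auto simp: diamond_def l1_norm_def)
qed simp


section \<open>The game of Trap\<close>

text \<open>
  The board is the graph induced by the relation \<open>E\<close> on the vertex set \<open>V\<close>.  A position is the
  nonempty list of the vertices visited so far, in chronological order; the token is at its last
  entry.  A strategy chooses the next vertex from the whole history.
\<close>

datatype player = First | Second

type_synonym 'v strategy = "'v list \<Rightarrow> 'v"

definition moves :: "('v \<Rightarrow> 'v \<Rightarrow> bool) \<Rightarrow> 'v set \<Rightarrow> 'v list \<Rightarrow> 'v set" where
  "moves E V h = {w \<in> V. E (last h) w \<and> w \<notin> set h}"

definition to_move :: "'v list \<Rightarrow> player" where
  "to_move h = (if odd (length h) then First else Second)"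

text \<open>Positions reachable from \<open>v\<close> when player \<open>P\<close> follows \<open>\<sigma>\<close> and the opponent is unrestricted.\<close>

inductive consistent ::
  "('v \<Rightarrow> 'v \<Rightarrow> bool) \<Rightarrow> 'v set \<Rightarrow> player \<Rightarrow> 'v strategy \<Rightarrow> 'v \<Rightarrow> 'v list \<Rightarrow> bool"
  for E V P \<sigma> v where
  start: "consistent E V P \<sigma> v [v]"
| step: "\<lbrakk>consistent E V P \<sigma> v h; w \<in> moves E V h; to_move h = P \<longrightarrow> w = \<sigma> h\<rbrakk>
           \<Longrightarrow> consistent E V P \<sigma> v (h @ [w])"

text \<open>
  A play is won by \<open>P\<close> if it stops with the opponent unable to move.  The first conjunct says
  that \<open>P\<close> always has a legal move and that \<open>\<sigma>\<close> selects one, so a play can only stop at the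
  opponent's turn; the second one excludes infinite plays, which nobody wins (it holds
  automatically if \<open>V\<close> is finite).
\<close>

definition winning_strategy ::
  "('v \<Rightarrow> 'v \<Rightarrow> bool) \<Rightarrow> 'v set \<Rightarrow> player \<Rightarrow> 'v \<Rightarrow> 'v strategy \<Rightarrow> bool" where
  "winning_strategy E V P v \<sigma> \<longleftrightarrow>
     (\<forall>h. consistent E V P \<sigma> v h \<and> to_move h = P \<longrightarrow> \<sigma> h \<in> moves E V h) \<and>
     \<not> (\<exists>x :: nat \<Rightarrow> 'v. \<forall>k. consistent E V P \<sigma> v (map x [0..<Suc k]))"

text \<open>An initial vertex off the board, i.e. a closed one, is by convention a first-player win.\<close>

definition wins :: "('v \<Rightarrow> 'v \<Rightarrow> bool) \<Rightarrow> 'v set \<Rightarrow> player \<Rightarrow> 'v \<Rightarrow> bool" where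
  "wins E V P v \<longleftrightarrow>
     (if v \<in> V then \<exists>\<sigma>. winning_strategy E V P v \<sigma> else P = First)"

text \<open>
  Odin moves from even vertices to odd ones.  Every move changes the parity, so he is the first
  player exactly if the initial vertex is even.
\<close>

definition odin :: "vertex \<Rightarrow> player" where
  "odin v = (if even_vertex v then First else Second)"

definition odin_wins :: "vertex set \<Rightarrow> vertex \<Rightarrow> bool" where
  "odin_wins V v \<longleftrightarrow> wins adjacent V (odin v) v"


section \<open>Random boards\<close>

text \<open>
  A configuration maps a vertex to \<open>True\<close> if it is closed.  Odd vertices are closed with
  probability \<open>p\<close> and even ones with probability \<open>q\<close>, independently.  Outside the diamond the
  configuration is a dummy constant.
\<close>

definition closed_config :: "nat \<Rightarrow> real \<Rightarrow> real \<Rightarrow> (vertex \<Rightarrow> bool) pmf" where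
  "closed_config n p q =
     Pi_pmf (diamond n) False (\<lambda>u. bernoulli_pmf (if even_vertex u then q else p))"

definition open_vertices :: "nat \<Rightarrow> (vertex \<Rightarrow> bool) \<Rightarrow> vertex set" where
  "open_vertices n \<omega> = {u \<in> diamond n. \<not> \<omega> u}"

text \<open>
  The initial vertices are those of the board, i.e. the open ones.  A closed odd initial vertex
  must be left out: Eve moves first there, so it counts as her win by convention.
\<close>

definition odin_wins_everywhere :: "nat \<Rightarrow> (vertex \<Rightarrow> bool) \<Rightarrow> bool" where
  "odin_wins_everywhere n \<omega> \<longleftrightarrow>
     (\<forall>v \<in> diamond n. v \<in> open_vertices n \<omega> \<longrightarrow> odin_wins (open_vertices n \<omega>) v)"

end

theory Submission
  imports Defs
begin

text \<open>
  In the coordinates \<open>((x + y) / 2, (x - y) / 2)\<close> the even vertices of the diamond become the unit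
  cells of a square grid and the odd vertices become the corners of these cells, two vertices being
  adjacent exactly if they are a cell and one of its corners.

  Suppose that every cell can be matched to an open corner of its own, none of them being the
  initial vertex.  Odin then wins by always moving along the matching: the corner that he moves to
  could have been visited before only from the cell matched to it, and the token has just arrived at
  that cell for the first time.  So he never gets stuck (\<open>wins_by_matching\<close>).

  By Hall's theorem such a matching exists for every initial vertex as soon as every nonempty set
  \<open>A\<close> of cells has more than \<open>|A|\<close> open corners, the excess of one paying for the initial vertex.
  Without closed corners there is a large margin: building the set of corners \<open>A + {0, 1}\<^sup>2\<close> one direction
  at a time shows that \<open>A\<close> has at least \<open>|A| + k + l + 1\<close> corners, where \<open>k\<close> and \<open>l\<close> count the columns
  and the rows that \<open>A\<close> meets (\<open>card_corners_ge\<close>).  An empty row or column between parts of \<open>A\<close> splits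
  the problem into two independent ones.  If there is none, then \<open>A\<close> lies in a \<open>k \<times> l\<close> rectangle of
  cells, so it is enough that such a rectangle has at most \<open>k + l\<close> closed corners.  Only
  rectangles have to be controlled, instead of all connected shapes (\<open>card_less_open_corners\<close>).

  A \<open>k \<times> l\<close> rectangle has \<open>N = (k + 1) (l + 1)\<close> corners, and it is crowded with probability at most
  \<open>(N choose t) p ^ t \<le> (e p N / t) ^ t\<close> with \<open>t = k + l + 1\<close>.  Since \<open>N / t\<close> is at most the
  shorter side plus one, hence at most \<open>2 n\<close>, the base of this power is at most \<open>2 e n p\<close>, which
  tends to \<open>0\<close> because \<open>n p < c / ln (1 / p)\<close>.  The sum over all rectangles is dominated by the
  smallest ones and has order \<open>n\<^sup>2 p\<^sup>3 = (n p)\<^sup>2 p\<close>; once \<open>2 e n p \<le> 1 / 8\<close> it is at most \<open>e p\<close>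
  (\<open>prob_not_sparse_le\<close>).
\<close>

section \<open>Systems of distinct representatives\<close>

text \<open>
  Hall's theorem by the argument of Halmos and Vaughan: if some nonempty proper subfamily is tight,
  it is served first and its values are withdrawn from the others; if none is, there is a slack of
  one everywhere, so that one index may take any of its values.
\<close>

lemma hall_distinct_representatives:
  fixes N :: "'i \<Rightarrow> 'b set"
  assumes "finite I" and "\<And>i. i \<in> I \<Longrightarrow> finite (N i)"
    and "\<And>J. J \<subseteq> I \<Longrightarrow> card J \<le> card (\<Union> (N ` J))"
  shows "\<exists>f. inj_on f I \<and> (\<forall>i\<in>I. f i \<in> N i)"
  using assms
proof (induction I arbitrary: N rule: finite_psubset_induct)
  case (psubset I)
  note fin = psubset.prems(1) and hall = psubset.prems(2)
  have finU: "finite (\<Union> (N ` J))" if "J \<subseteq> I" for J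
    using that fin finite_subset[OF that \<open>finite I\<close>] by auto
  show ?case
  proof (cases "\<exists>J. J \<subset> I \<and> J \<noteq> {} \<and> card J = card (\<Union> (N ` J))")
    case True
    then obtain J where J: "J \<subset> I" "J \<noteq> {}" "card J = card (\<Union> (N ` J))" by blast
    let ?U = "\<Union> (N ` J)"
    have "\<exists>f. inj_on f J \<and> (\<forall>i\<in>J. f i \<in> N i)"
      by (rule psubset.IH) (use J fin hall in auto)
    then obtain f where f: "inj_on f J" "\<And>i. i \<in> J \<Longrightarrow> f i \<in> N i" by blast
    have "\<exists>g. inj_on g (I - J) \<and> (\<forall>i\<in>I - J. g i \<in> N i - ?U)"
    proof (rule psubset.IH)
      show "I - J \<subset> I" using J by blast
      fix L assume L: "L \<subseteq> I - J"
      have fs: "finite J" "finite L"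
        using J L \<open>finite I\<close> by (auto intro: finite_subset)
      have "card J + card L = card (J \<union> L)"
        using L fs by (intro card_Un_disjoint[symmetric]) auto
      also have "\<dots> \<le> card (\<Union> (N ` (J \<union> L)))"
        using J L by (intro hall) auto
      also have "\<Union> (N ` (J \<union> L)) = ?U \<union> \<Union> ((\<lambda>i. N i - ?U) ` L)" by auto
      also have "card \<dots> \<le> card ?U + card (\<Union> ((\<lambda>i. N i - ?U) ` L))"
        by (rule card_Un_le)
      finally show "card L \<le> card (\<Union> ((\<lambda>i. N i - ?U) ` L))" using J by simp
    qed (use fin in auto)
    then obtain g where g: "inj_on g (I - J)" "\<And>i. i \<in> I - J \<Longrightarrow> g i \<in> N i - ?U" by blast
    let ?h = "\<lambda>i. if i \<in> J then f i else g i"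
    have "inj_on ?h I"
    proof (rule inj_onI)
      fix x y assume "x \<in> I" "y \<in> I" "?h x = ?h y"
      moreover have "f z \<in> ?U" if "z \<in> J" for z using f(2) that by blast
      moreover have "g z \<notin> ?U" if "z \<in> I - J" for z using g(2) that by blast
      ultimately show "x = y"
        using inj_onD[OF f(1), of x y] inj_onD[OF g(1), of x y]
        by (cases "x \<in> J"; cases "y \<in> J") (simp_all, metis+)
    qed
    moreover have "\<forall>i\<in>I. ?h i \<in> N i" using f g by auto
    ultimately show ?thesis by blast
  next
    case False
    show ?thesis
    proof (cases "I = {}")
      case False
      then obtain i where i: "i \<in> I" by blast
      have "card {i} \<le> card (\<Union> (N ` {i}))" using i by (intro hall) auto
      then have "N i \<noteq> {}" by auto
      then obtain x where x: "x \<in> N i" by blast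
      have "\<exists>g. inj_on g (I - {i}) \<and> (\<forall>j\<in>I - {i}. g j \<in> N j - {x})"
      proof (rule psubset.IH)
        show "I - {i} \<subset> I" using i by blast
        fix L assume L: "L \<subseteq> I - {i}"
        show "card L \<le> card (\<Union> ((\<lambda>j. N j - {x}) ` L))"
        proof (cases "L = {}")
          case False
          have "card L \<le> card (\<Union> (N ` L))" using L by (intro hall) auto
          moreover have "card L \<noteq> card (\<Union> (N ` L))"
            using \<open>\<nexists>J. _ J\<close> False L i by blast
          ultimately have "card L < card (\<Union> (N ` L))" by linarith
          moreover have "\<Union> ((\<lambda>j. N j - {x}) ` L) = \<Union> (N ` L) - {x}" by auto
          ultimately show ?thesis using diff_card_le_card_Diff[of "{x}" "\<Union> (N ` L)"] by simp
        qed simp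
      qed (use fin in auto)
      then obtain g where g: "inj_on g (I - {i})" "\<And>j. j \<in> I - {i} \<Longrightarrow> g j \<in> N j - {x}" by blast
      have "inj_on (g(i := x)) I"
        using g by (fastforce simp: inj_on_def)
      moreover have "\<forall>j\<in>I. (g(i := x)) j \<in> N j" using g x by auto
      ultimately show ?thesis by blast
    qed auto
  qed
qed

section \<open>Winning Trap by following a matching\<close>

text \<open>
  The last clause is the reason why the next vertex of the matching is always unvisited: an
  opponent's vertex other than the start was entered from its partner, and the current vertex, being
  visited for the first time, has not been left yet.
\<close>

lemma consistent_matching_invariant:
  assumes v: "v \<in> V"
    and alternates: "\<And>u w. u \<in> V \<Longrightarrow> w \<in> V \<Longrightarrow> E u w \<Longrightarrow> w \<in> X \<longleftrightarrow> u \<notin> X"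
    and mover: "P = First \<longleftrightarrow> v \<in> X"
    and h: "consistent E V P (\<lambda>h. f (last h)) v h"
  shows "h \<noteq> [] \<and> set h \<subseteq> V \<and> distinct h \<and> (to_move h = P \<longleftrightarrow> last h \<in> X) \<and>
    set h - X - {v} \<subseteq> f ` (set (butlast h) \<inter> X)"
  using h
proof induction
  case start
  then show ?case using v mover by (cases P) (auto simp: to_move_def)
next
  case (step h w)
  have w: "w \<in> V" "E (last h) w" "w \<notin> set h" using step.hyps by (auto simp: moves_def)
  have l: "last h \<in> set h" using step.IH by auto
  then have "w \<in> X \<longleftrightarrow> last h \<notin> X" using alternates w step.IH by blast
  moreover have "to_move (h @ [w]) = P \<longleftrightarrow> to_move h \<noteq> P"
    by (cases P) (auto simp: to_move_def)
  moreover have "set (butlast h) \<subseteq> set h" by (meson in_set_butlastD subsetI)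
  moreover have "set (h @ [w]) - X - {v} \<subseteq> f ` (set h \<inter> X)"
  proof -
    have "set h - X - {v} \<subseteq> f ` (set h \<inter> X)"
      using step.IH \<open>set (butlast h) \<subseteq> set h\<close> by blast
    moreover have "w \<in> f ` (set h \<inter> X)" if "w \<notin> X"
      using that \<open>w \<in> X \<longleftrightarrow> last h \<notin> X\<close> step.IH step.hyps(3) l by auto
    ultimately show ?thesis by auto
  qed
  ultimately show ?case using step.IH w by auto
qed

lemma wins_by_matching:
  assumes fin: "finite V" and v: "v \<in> V"
    and alternates: "\<And>u w. u \<in> V \<Longrightarrow> w \<in> V \<Longrightarrow> E u w \<Longrightarrow> w \<in> X \<longleftrightarrow> u \<notin> X"
    and mover: "P = First \<longleftrightarrow> v \<in> X"
    and inj: "inj_on f (V \<inter> X)"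
    and f: "\<And>u. u \<in> V \<inter> X \<Longrightarrow> f u \<in> V \<and> E u (f u) \<and> f u \<noteq> v"
  shows "wins E V P v"
proof -
  let ?\<sigma> = "\<lambda>h. f (last h)"
  have inv: "h \<noteq> [] \<and> set h \<subseteq> V \<and> distinct h \<and> (to_move h = P \<longleftrightarrow> last h \<in> X) \<and>
      set h - X - {v} \<subseteq> f ` (set (butlast h) \<inter> X)"
    if "consistent E V P ?\<sigma> v h" for h
    using v _ mover that by (rule consistent_matching_invariant) (rule alternates)
  have "?\<sigma> h \<in> moves E V h" if h: "consistent E V P ?\<sigma> v h" and t: "to_move h = P" for h
  proof -
    have h': "h \<noteq> []" "set h \<subseteq> V" "distinct h" "last h \<in> X"
      "set h - X - {v} \<subseteq> f ` (set (butlast h) \<inter> X)"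
      using inv[OF h] t by blast+
    then have l: "last h \<in> V \<inter> X" by auto
    have "f (last h) \<notin> set h"
    proof
      assume "f (last h) \<in> set h"
      moreover have "f (last h) \<notin> X" using alternates f[OF l] l by blast
      ultimately obtain u where u: "u \<in> set (butlast h)" "u \<in> X" "f (last h) = f u"
        using h'(5) f[OF l] by blast
      then have "u \<in> V" using h'(2) by (meson in_set_butlastD subsetD)
      then have "u = last h" using inj_onD[OF inj u(3) l] u(2) by blast
      moreover have "last h \<notin> set (butlast h)"
      proof -
        have "distinct (butlast h @ [last h])" using h'(1,3) by simp
        then show ?thesis by simp
      qed
      ultimately show False using u by simp
    qed
    then show ?thesis using f[OF l] by (auto simp: moves_def)
  qed
  moreover have "\<not> (\<exists>x :: nat \<Rightarrow> 'a. \<forall>k. consistent E V P ?\<sigma> v (map x [0..<Suc k]))"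
  proof
    assume "\<exists>x :: nat \<Rightarrow> 'a. \<forall>k. consistent E V P ?\<sigma> v (map x [0..<Suc k])"
    then obtain x where x: "consistent E V P ?\<sigma> v (map x [0..<Suc k])" for k by blast
    have *: "set (map x [0..<Suc k]) \<subseteq> V \<and> distinct (map x [0..<Suc k])" for k
      using inv[OF x] by blast
    have "card (set (map x [0..<Suc (card V)])) = Suc (card V)"
      using *[of "card V"] by (subst distinct_card) auto
    moreover have "card (set (map x [0..<Suc (card V)])) \<le> card V"
      using *[of "card V"] fin by (intro card_mono) auto
    ultimately show False by simp
  qed
  ultimately show ?thesis using v unfolding wins_def winning_strategy_def by auto
qed

section \<open>Cells and their corners\<close>

definition square :: "int \<times> int \<Rightarrow> (int \<times> int) set" where
  "square c = {fst c, fst c + 1} \<times> {snd c, snd c + 1}"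

definition corners :: "(int \<times> int) set \<Rightarrow> (int \<times> int) set" where
  "corners A = \<Union> (square ` A)"

lemma finite_corners: "finite A \<Longrightarrow> finite (corners A)"
  by (auto simp: corners_def square_def)

text \<open>
  The corners of the cells in \<open>A\<close> are \<open>A + {0, 1}\<^sup>2\<close>, obtained from \<open>A\<close> by adding a shifted copy first
  in one direction and then in the other.  A shift moves the last point of every line out of the set
  and thus contributes at least one new point per nonempty line.
\<close>

lemma card_insert_shift:
  fixes S :: "int set"
  assumes "finite S" "S \<noteq> {}"
  shows "card S + 1 \<le> card (S \<union> (\<lambda>x. x + 1) ` S)"
proof -
  have "Max S + 1 \<notin> S" using Max_ge[of S "Max S + 1"] assms by auto
  then have "card S + 1 = card (insert (Max S + 1) S)" using assms by simp
  also have "\<dots> \<le> card (S \<union> (\<lambda>x. x + 1) ` S)" using assms by (intro card_mono) auto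
  finally show ?thesis .
qed

lemma card_shift_fst:
  fixes B :: "(int \<times> int) set"
  assumes "finite B"
  shows "card B + card (snd ` B) \<le> card (B \<union> (\<lambda>(x, y). (x + 1, y)) ` B)"
proof -
  define r where "r y = Max {x. (x, y) \<in> B}" for y
  have fin: "finite {x. (x, y) \<in> B}" for y
    by (rule finite_subset[OF _ finite_imageI[OF assms, of fst]]) force
  have r: "(r y, y) \<in> B" if "y \<in> snd ` B" for y
  proof -
    have "{x. (x, y) \<in> B} \<noteq> {}" using that by force
    from Max_in[OF fin this] show ?thesis by (simp add: r_def)
  qed
  have r': "(r y + 1, y) \<notin> B" for y
    using Max_ge[OF fin, of "r y + 1" y] unfolding r_def by auto
  let ?R = "(\<lambda>y. (r y + 1, y)) ` snd ` B"
  have "card B + card (snd ` B) = card B + card ?R"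
    by (subst (2) card_image) (auto simp: inj_on_def)
  also have "\<dots> = card (B \<union> ?R)"
    using assms r' by (intro card_Un_disjoint[symmetric]) auto
  also have "\<dots> \<le> card (B \<union> (\<lambda>(x, y). (x + 1, y)) ` B)"
  proof (rule card_mono)
    show "finite (B \<union> (\<lambda>(x, y). (x + 1, y)) ` B)" using assms by simp
    have "(r y + 1, y) \<in> (\<lambda>(x, y). (x + 1, y)) ` B" if "y \<in> snd ` B" for y
      using r[OF that] by (intro image_eqI[of _ _ "(r y, y)"]) auto
    then show "B \<union> ?R \<subseteq> B \<union> (\<lambda>(x, y). (x + 1, y)) ` B" by blast
  qed
  finally show ?thesis .
qed

lemma card_shift_snd:
  fixes B :: "(int \<times> int) set"
  assumes "finite B"
  shows "card B + card (fst ` B) \<le> card (B \<union> (\<lambda>(x, y). (x, y + 1)) ` B)"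
proof -
  have "card (prod.swap ` B) + card (snd ` prod.swap ` B)
      \<le> card (prod.swap ` B \<union> (\<lambda>(x, y). (x + 1, y)) ` prod.swap ` B)"
    by (rule card_shift_fst) (use assms in simp)
  also have "prod.swap ` B \<union> (\<lambda>(x, y). (x + 1, y)) ` prod.swap ` B
      = prod.swap ` (B \<union> (\<lambda>(x, y). (x, y + 1)) ` B)"
    by (auto simp: image_Un image_image case_prod_unfold)
  finally show ?thesis
    by (simp only: card_image[OF inj_on_subset[OF inj_swap subset_UNIV]] image_image snd_swap)
qed

text \<open>
  The first shift gains one point per row and also adds a column to those that are met,
  which is where the summand \<open>1\<close> comes from when the second shift gains one point per column.
\<close>

lemma card_corners_ge:
  assumes "finite A" "A \<noteq> {}"
  shows "card A + card (fst ` A) + card (snd ` A) + 1 \<le> card (corners A)"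
proof -
  let ?B = "A \<union> (\<lambda>(x, y). (x + 1, y)) ` A"
  have square: "square c = {c, (fst c + 1, snd c), (fst c, snd c + 1), (fst c + 1, snd c + 1)}" for c
    by (cases c) (auto simp: square_def)
  have "corners A = ?B \<union> (\<lambda>(x, y). (x, y + 1)) ` ?B"
    unfolding corners_def square by (simp add: image_Un image_image case_prod_unfold) blast
  moreover have "card ?B + card (fst ` ?B) \<le> card (?B \<union> (\<lambda>(x, y). (x, y + 1)) ` ?B)"
    by (rule card_shift_snd) (use assms in simp)
  moreover have "card A + card (snd ` A) \<le> card ?B"
    by (rule card_shift_fst) fact
  moreover have "fst ` ?B = fst ` A \<union> (\<lambda>x. x + 1) ` fst ` A"
    by (auto simp: image_Un image_image case_prod_unfold)
  moreover have "card (fst ` A) + 1 \<le> card (fst ` A \<union> (\<lambda>x. x + 1) ` fst ` A)"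
    by (rule card_insert_shift) (use assms in auto)
  ultimately show ?thesis by simp
qed

text \<open>The corners of \<open>k\<close> columns and \<open>l\<close> rows of cells, hence \<open>k + 1\<close> by \<open>l + 1\<close> points.\<close>

definition rect :: "int \<Rightarrow> int \<Rightarrow> nat \<Rightarrow> nat \<Rightarrow> (int \<times> int) set" where
  "rect i j k l = {i..i + int k} \<times> {j..j + int l}"

text \<open>
  The bound \<open>k + l\<close> is one less than the surplus of corners over cells in a full \<open>k \<times> l\<close> rectangle, so
  a sparse set leaves each rectangle with a surplus of open corners.
\<close>

definition sparse :: "int set \<Rightarrow> (int \<times> int) set \<Rightarrow> bool" where
  "sparse W K \<longleftrightarrow> (\<forall>i j k l. 0 < k \<longrightarrow> 0 < l \<longrightarrow> rect i j k l \<subseteq> W \<times> W \<longrightarrow>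
     card (K \<inter> rect i j k l) \<le> k + l)"

lemma int_interval_if_no_gap:
  fixes S :: "int set"
  assumes "finite S" "S \<noteq> {}" "\<not> (\<exists>t. t \<notin> S \<and> (\<exists>s\<in>S. s < t) \<and> (\<exists>s\<in>S. t < s))"
  shows "S = {Min S..Max S}"
proof
  show "S \<subseteq> {Min S..Max S}" using assms by auto
  show "{Min S..Max S} \<subseteq> S"
  proof
    fix t assume t: "t \<in> {Min S..Max S}"
    show "t \<in> S"
    proof (rule ccontr)
      assume "t \<notin> S"
      then have "Min S < t" "t < Max S"
        using t Min_in[OF assms(1,2)] Max_in[OF assms(1,2)] by (auto simp: order.order_iff_strict)
      then show False using assms(3) \<open>t \<notin> S\<close> Min_in[OF assms(1,2)] Max_in[OF assms(1,2)] by blast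
    qed
  qed
qed

lemma card_open_corners_Un:
  assumes "finite A" "finite B" "A \<inter> B = {}" "corners A \<inter> corners B = {}"
    and "card A < card (corners A - K)" "card B < card (corners B - K)"
  shows "card (A \<union> B) < card (corners (A \<union> B) - K)"
proof -
  have "corners (A \<union> B) - K = (corners A - K) \<union> (corners B - K)"
    by (auto simp: corners_def)
  moreover have "card ((corners A - K) \<union> (corners B - K)) = card (corners A - K) + card (corners B - K)"
    using assms(1-4) finite_corners by (intro card_Un_disjoint) auto
  moreover have "card (A \<union> B) = card A + card B" using assms by (intro card_Un_disjoint) auto
  ultimately show ?thesis using assms by simp
qed

text \<open>
  A set of cells whose projections have no gaps meets every row and column of its bounding
  rectangle, so its surplus of corners is at least that of the rectangle, while it has no more closed
  corners.  A gap separates the cells into two parts without common corners, whose surpluses add up.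
\<close>

lemma card_less_open_corners:
  assumes "sparse W K" and "finite A" "A \<noteq> {}" "corners A \<subseteq> W \<times> W"
    and W: "W = {a..b}"
  shows "card A < card (corners A - K)"
  using assms(2-4)
proof (induction A rule: finite_psubset_induct)
  case (psubset A)
  \<comment> \<open>The value \<open>t\<close> is a gap in the projection \<open>\<phi>\<close>.\<close>
  have split: ?case
    if "\<And>c. c \<in> A \<Longrightarrow> \<phi> c \<noteq> t" "c1 \<in> A" "\<phi> c1 < t" "c2 \<in> A" "t < \<phi> c2"
      and \<phi>: "\<phi> = fst \<or> \<phi> = snd" for \<phi> :: "int \<times> int \<Rightarrow> int" and t c1 c2
  proof -
    let ?A = "{c \<in> A. \<phi> c < t}" and ?B = "{c \<in> A. t < \<phi> c}"
    have less: "card C < card (corners C - K)" if "C \<subset> A" "C \<noteq> {}" for C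
    proof (rule psubset.IH)
      show "corners C \<subseteq> W \<times> W" using that(1) psubset.prems(2) unfolding corners_def by blast
    qed fact+
    have "c1 \<in> ?A" "c2 \<notin> ?A" "c1 \<notin> ?B" "c2 \<in> ?B" using that(2-5) by simp_all
    then have "?A \<subset> A" "?A \<noteq> {}" "?B \<subset> A" "?B \<noteq> {}" using that(2,4) by blast+
    then have "card ?A < card (corners ?A - K)" "card ?B < card (corners ?B - K)"
      using less by blast+
    moreover have "corners ?A \<inter> corners ?B = {}"
    proof -
      have "\<phi> z \<le> t" if "z \<in> corners ?A" for z
        using that \<phi> by (auto simp: corners_def square_def)
      moreover have "t < \<phi> z" if "z \<in> corners ?B" for z
        using that \<phi> by (auto simp: corners_def square_def)
      ultimately show ?thesis by force
    qed
    ultimately have "card (?A \<union> ?B) < card (corners (?A \<union> ?B) - K)"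
      using psubset.hyps by (intro card_open_corners_Un) auto
    moreover have "?A \<union> ?B = A" using that(1) by force
    ultimately show ?thesis by simp
  qed
  have fin: "finite A" "A \<noteq> {}" using psubset by auto
  show ?case
  proof (cases "\<exists>\<phi> t. (\<phi> = fst \<or> \<phi> = snd) \<and> t \<notin> \<phi> ` A \<and> (\<exists>s\<in>\<phi> ` A. s < t) \<and> (\<exists>s\<in>\<phi> ` A. t < s)")
    case True
    then obtain \<phi> t c1 c2 where "\<phi> = fst \<or> \<phi> = snd" "t \<notin> \<phi> ` A"
      "c1 \<in> A" "\<phi> c1 < t" "c2 \<in> A" "t < \<phi> c2" by blast
    then show ?thesis by (intro split[of \<phi> t c1 c2]) auto
  next
    case False
    then have proj: "fst ` A = {Min (fst ` A)..Max (fst ` A)}" "snd ` A = {Min (snd ` A)..Max (snd ` A)}"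
      using int_interval_if_no_gap[of "fst ` A"] int_interval_if_no_gap[of "snd ` A"] fin by blast+
    define i j k l where "i = Min (fst ` A)" and "j = Min (snd ` A)"
      and "k = card (fst ` A)" and "l = card (snd ` A)"
    have pos: "0 < k" "0 < l" using fin by (auto simp: k_def l_def card_gt_0_iff)
    have f: "fst ` A = {i..i + int k - 1}"
    proof -
      have "i \<le> Max (fst ` A)" using fin by (simp add: i_def)
      moreover have "k = nat (Max (fst ` A) - i + 1)" using proj(1) i_def k_def
        by (metis card_atLeastAtMost_int add_diff_eq diff_add_eq)
      ultimately show ?thesis using proj(1) i_def by simp
    qed
    have s: "snd ` A = {j..j + int l - 1}"
    proof -
      have "j \<le> Max (snd ` A)" using fin by (simp add: j_def)
      moreover have "l = nat (Max (snd ` A) - j + 1)" using proj(2) j_def l_def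
        by (metis card_atLeastAtMost_int add_diff_eq diff_add_eq)
      ultimately show ?thesis using proj(2) j_def by simp
    qed
    have sub: "corners A \<subseteq> rect i j k l"
    proof
      fix z assume "z \<in> corners A"
      then obtain c where c: "c \<in> A" "z \<in> square c" by (auto simp: corners_def)
      then have "fst c \<in> {i..i + int k - 1}" "snd c \<in> {j..j + int l - 1}" using f s by blast+
      then show "z \<in> rect i j k l" using c by (auto simp: square_def rect_def mem_Times_iff)
    qed
    have inW: "rect i j k l \<subseteq> W \<times> W"
    proof -
      have bounds: "a \<le> fst c" "fst c + 1 \<le> b" "a \<le> snd c" "snd c + 1 \<le> b" if "c \<in> A" for c
      proof -
        have "square c \<subseteq> {a..b} \<times> {a..b}"
          using psubset.prems(2) that W unfolding corners_def by blast
        then show "a \<le> fst c" "fst c + 1 \<le> b" "a \<le> snd c" "snd c + 1 \<le> b"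
          by (auto simp: square_def)
      qed
      have "i \<in> fst ` A" "i + int k - 1 \<in> fst ` A" "j \<in> snd ` A" "j + int l - 1 \<in> snd ` A"
        using f s pos by auto
      then have "a \<le> i" "i + int k \<le> b" "a \<le> j" "j + int l \<le> b"
        using bounds by fastforce+
      then show ?thesis using W by (auto simp: rect_def)
    qed
    have "card (corners A \<inter> K) \<le> card (K \<inter> rect i j k l)"
      using sub by (intro card_mono) (auto simp: rect_def)
    also have "\<dots> \<le> k + l" using \<open>sparse W K\<close> inW pos unfolding sparse_def by blast
    finally have "card (corners A \<inter> K) \<le> k + l" .
    moreover have "card A + k + l + 1 \<le> card (corners A)"
      unfolding k_def l_def by (rule card_corners_ge) fact+
    moreover have "card (corners A - K) = card (corners A) - card (corners A \<inter> K)"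
      using finite_corners[OF fin(1)] by (intro card_Diff_subset_Int) auto
    ultimately show ?thesis by linarith
  qed
qed

section \<open>The diamond as a square of cells\<close>

text \<open>
  Rounding up lets the same formula serve both parities: an even vertex is sent to the lower left
  corner of its cell, an odd vertex to the grid point that represents it.
\<close>

definition rot :: "vertex \<Rightarrow> int \<times> int" where
  "rot u = ((fst u + snd u + 1) div 2, (fst u - snd u + 1) div 2)"

lemma adjacent_iff:
  "adjacent (x, y) w \<longleftrightarrow> w \<in> {(x + 1, y), (x - 1, y), (x, y + 1), (x, y - 1)}"
  by (cases w) (auto simp: adjacent_def l1_norm_def)

lemma adjacent_parity: "adjacent u w \<Longrightarrow> even_vertex w \<longleftrightarrow> \<not> even_vertex u"
  by (cases u) (auto simp: adjacent_iff even_vertex_def)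

lemma even_vertexE:
  assumes "even_vertex u"
  obtains a b where "u = (a + b, a - b)"
proof -
  have "even (fst u + snd u)" using assms by (simp only: even_vertex_def)
  then obtain a where a: "fst u + snd u = 2 * a" by (rule evenE)
  show ?thesis by (rule that[of a "fst u - a"]) (use a in \<open>auto simp: prod_eq_iff\<close>)
qed

lemma odd_vertexE:
  assumes "\<not> even_vertex u"
  obtains a b where "u = (a + b - 1, a - b)"
proof -
  have "odd (fst u + snd u)" using assms by (simp add: even_vertex_def)
  then obtain a where a: "fst u + snd u = 2 * a + 1" by (rule oddE)
  show ?thesis by (rule that[of "a + 1" "fst u - a"]) (use a in \<open>auto simp: prod_eq_iff\<close>)
qed

lemma rot_even: "rot (a + b, a - b) = (a, b)"
  by (simp add: rot_def)

lemma rot_odd: "rot (a + b - 1, a - b) = (a, b)"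
  by (simp add: rot_def)

lemma inj_on_rot_even: "inj_on rot {u. even_vertex u}"
  by (rule inj_onI) (auto elim!: even_vertexE simp: rot_even)

lemma rot_neighbours:
  assumes "even_vertex u"
  shows "rot ` {w. adjacent u w} = square (rot u)"
proof -
  obtain a b where u: "u = (a + b, a - b)" using assms by (rule even_vertexE)
  have "rot (a + b + 1, a - b) = (a + 1, b + 1)" "rot (a + b - 1, a - b) = (a, b)"
    "rot (a + b, a - b + 1) = (a + 1, b)" "rot (a + b, a - b - 1) = (a, b + 1)"
    by (auto simp: rot_def)
  moreover have "{w. adjacent u w} =
      {(a + b + 1, a - b), (a + b - 1, a - b), (a + b, a - b + 1), (a + b, a - b - 1)}"
    unfolding u adjacent_iff by auto
  ultimately show ?thesis
    unfolding u rot_even by (auto simp: square_def)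
qed

text \<open>
  The boundary of the diamond consists of odd vertices, so no cell loses a corner by the
  restriction to the diamond.
\<close>

lemma neighbour_in_diamond:
  assumes "even_vertex u" "u \<in> diamond n" "adjacent u w"
  shows "w \<in> diamond n"
proof -
  obtain a b where u: "u = (a + b, a - b)" using assms(1) by (rule even_vertexE)
  have "\<bar>a + b\<bar> + \<bar>a - b\<bar> < 2 * int n" using assms(2) by (simp add: u diamond_def l1_norm_def)
  \<comment> \<open>The left-hand side is even, being \<open>2 max \<bar>a\<bar> \<bar>b\<bar>\<close>.\<close>
  then have "\<bar>a + b\<bar> + \<bar>a - b\<bar> + 1 < 2 * int n" by (simp add: abs_if split: if_splits)
  then show ?thesis
    using assms(3) unfolding u adjacent_iff by (auto simp: diamond_def l1_norm_def)
qed

lemma odd_in_diamond_iff: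
  assumes "\<not> even_vertex w"
  shows "w \<in> diamond n \<longleftrightarrow> rot w \<in> {1 - int n..int n} \<times> {1 - int n..int n}"
proof -
  obtain a b where w: "w = (a + b - 1, a - b)" using assms by (rule odd_vertexE)
  have "\<bar>a + b - 1\<bar> + \<bar>a - b\<bar> < 2 * int n \<longleftrightarrow>
      1 - int n \<le> a \<and> a \<le> int n \<and> 1 - int n \<le> b \<and> b \<le> int n" by arith
  then show ?thesis by (simp add: w rot_odd diamond_def l1_norm_def)
qed

definition closed_corners :: "nat \<Rightarrow> (vertex \<Rightarrow> bool) \<Rightarrow> (int \<times> int) set" where
  "closed_corners n \<omega> = rot ` {w \<in> diamond n. \<not> even_vertex w \<and> \<omega> w}"

text \<open>
  The strict inequality of \<open>card_less_open_corners\<close> leaves one corner to spare.  This pays for the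
  initial vertex, which must not be used by the matching when Eve starts.
\<close>

lemma odin_wins_everywhere_if_sparse:
  assumes sparse: "sparse {1 - int n..int n} (closed_corners n \<omega>)"
  shows "odin_wins_everywhere n \<omega>"
  unfolding odin_wins_everywhere_def odin_wins_def
proof (intro ballI impI)
  fix v assume v: "v \<in> open_vertices n \<omega>"
  let ?V = "open_vertices n \<omega>" and ?X = "{u. even_vertex u}"
  let ?N = "\<lambda>u. {w \<in> ?V. adjacent u w \<and> w \<noteq> v}"
  have finV: "finite ?V" using finite_diamond by (simp add: open_vertices_def)
  have "\<exists>f. inj_on f (?V \<inter> ?X) \<and> (\<forall>u\<in>?V \<inter> ?X. f u \<in> ?N u)"
  proof (rule hall_distinct_representatives)
    fix J assume J: "J \<subseteq> ?V \<inter> ?X"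
    show "card J \<le> card (\<Union> (?N ` J))"
    proof (cases "J = {}")
      case False
      let ?A = "rot ` J" and ?M = "{w \<in> ?V. \<exists>u\<in>J. adjacent u w}"
      have nbr: "\<exists>u w. u \<in> J \<and> adjacent u w \<and> z = rot w \<and> w \<in> diamond n \<and> \<not> even_vertex w"
        if z: "z \<in> corners ?A" for z
      proof -
        obtain u where u: "u \<in> J" "z \<in> square (rot u)" using z unfolding corners_def by blast
        then have ev: "even_vertex u" "u \<in> diamond n" using J by (auto simp: open_vertices_def)
        then obtain w where w: "adjacent u w" "z = rot w" using u rot_neighbours by blast
        then show ?thesis
          using u ev neighbour_in_diamond adjacent_parity by blast
      qed
      have "finite J" using J finV by (auto intro: finite_subset)
      moreover have "corners ?A \<subseteq> {1 - int n..int n} \<times> {1 - int n..int n}"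
      proof
        fix z assume "z \<in> corners ?A"
        then obtain w where "z = rot w" "w \<in> diamond n" "\<not> even_vertex w" using nbr by blast
        then show "z \<in> {1 - int n..int n} \<times> {1 - int n..int n}" using odd_in_diamond_iff by blast
      qed
      ultimately have "card ?A < card (corners ?A - closed_corners n \<omega>)"
        using False by (intro card_less_open_corners[OF sparse]) auto
      also have "\<dots> \<le> card (rot ` ?M)"
      proof (rule card_mono)
        show "finite (rot ` ?M)" using finV by simp
        show "corners ?A - closed_corners n \<omega> \<subseteq> rot ` ?M"
        proof
          fix z assume z: "z \<in> corners ?A - closed_corners n \<omega>"
          then obtain u w where w: "u \<in> J" "adjacent u w" "z = rot w" "w \<in> diamond n" "\<not> even_vertex w"
            using nbr by blast
          then have "\<not> \<omega> w" using z by (auto simp: closed_corners_def)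
          then show "z \<in> rot ` ?M" using w by (auto simp: open_vertices_def)
        qed
      qed
      also have "\<dots> \<le> card ?M" using finV by (intro card_image_le) simp
      also have "card ?M \<le> card (?M - {v}) + 1"
        using diff_card_le_card_Diff[of "{v}" ?M] by simp
      also have "?M - {v} = \<Union> (?N ` J)" by auto
      finally have "card ?A \<le> card (\<Union> (?N ` J))" by simp
      moreover have "card ?A = card J"
        using J by (intro card_image inj_on_subset[OF inj_on_rot_even]) auto
      ultimately show ?thesis by simp
    qed simp
  qed (use finV in auto)
  then obtain f where f: "inj_on f (?V \<inter> ?X)" "\<forall>u\<in>?V \<inter> ?X. f u \<in> ?N u" by blast
  show "wins adjacent ?V (odin v) v"
  proof (rule wins_by_matching[where X = ?X and f = f])
    show "w \<in> ?X \<longleftrightarrow> u \<notin> ?X" if "adjacent u w" for u w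
      using adjacent_parity[OF that] by simp
    show "odin v = First \<longleftrightarrow> v \<in> ?X" by (simp add: odin_def)
    show "f u \<in> ?V \<and> adjacent u (f u) \<and> f u \<noteq> v" if "u \<in> ?V \<inter> ?X" for u
      using f(2) that by blast
  qed (use finV v f in auto)
qed

section \<open>Crowded rectangles are unlikely\<close>

text \<open>A union bound over the \<open>t\<close>-element sets all of whose members may be true.\<close>

lemma prob_many_true_le:
  fixes I :: "'i set"
  assumes I: "finite I" "S \<subseteq> I" and Q: "\<And>i. i \<in> S \<Longrightarrow> Q i = bernoulli_pmf p"
    and p: "0 \<le> p" "p \<le> 1"
  shows "measure_pmf.prob (Pi_pmf I False Q) {\<omega>. t \<le> card {i \<in> S. \<omega> i}}
    \<le> real (card S choose t) * p ^ t"
proof -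
  let ?P = "measure_pmf.prob (Pi_pmf I False Q)"
  let ?\<T> = "{T. T \<subseteq> S \<and> card T = t}"
  have finS: "finite S" using I finite_subset by blast
  have fin: "finite ?\<T>" using finS by (auto intro: finite_subset[of _ "Pow S"])
  have all: "?P {\<omega>. \<forall>i\<in>T. \<omega> i} = p ^ t" if T: "T \<in> ?\<T>" for T
  proof -
    let ?B = "\<lambda>i. if i \<in> T then {True} else UNIV"
    have TI: "T \<subseteq> I" using T I by blast
    then have "{\<omega>. \<forall>i\<in>T. \<omega> i} = Pi I ?B" by (auto simp: Pi_def)
    then have "?P {\<omega>. \<forall>i\<in>T. \<omega> i} = (\<Prod>i\<in>I. measure_pmf.prob (Q i) (?B i))"
      using measure_Pi_pmf_Pi[OF I(1)] by simp
    also have "\<dots> = (\<Prod>i\<in>I. if i \<in> T then p else 1)"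
      using T Q p by (intro prod.cong) (auto simp: measure_pmf_single)
    also have "\<dots> = p ^ card T"
      using I(1) TI by (simp add: prod.If_cases Int_absorb1)
    finally show ?thesis using T by simp
  qed
  have "{\<omega>. t \<le> card {i \<in> S. \<omega> i}} \<subseteq> (\<Union>T\<in>?\<T>. {\<omega>. \<forall>i\<in>T. \<omega> i})"
  proof
    fix \<omega> assume "\<omega> \<in> {\<omega>. t \<le> card {i \<in> S. \<omega> i}}"
    then obtain T where "T \<subseteq> {i \<in> S. \<omega> i}" "card T = t"
      by (auto elim: obtain_subset_with_card_n)
    then show "\<omega> \<in> (\<Union>T\<in>?\<T>. {\<omega>. \<forall>i\<in>T. \<omega> i})" by blast
  qed
  then have "?P {\<omega>. t \<le> card {i \<in> S. \<omega> i}} \<le> ?P (\<Union>T\<in>?\<T>. {\<omega>. \<forall>i\<in>T. \<omega> i})"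
    by (intro measure_pmf.finite_measure_mono) auto
  also have "\<dots> \<le> (\<Sum>T\<in>?\<T>. ?P {\<omega>. \<forall>i\<in>T. \<omega> i})"
    using fin by (intro measure_pmf.finite_measure_subadditive_finite) auto
  also have "\<dots> = real (card ?\<T>) * p ^ t" using all by simp
  also have "card ?\<T> = (card S choose t)" using n_subsets[OF finS] by simp
  finally show ?thesis .
qed

text \<open>The left-hand side divided by \<open>fact t\<close> is a single term of the exponential series at \<open>t\<close>.\<close>

lemma power_self_le_exp_fact: "real t ^ t \<le> exp 1 ^ t * fact t"
proof -
  have "(\<Sum>i\<in>{t}. real t ^ i /\<^sub>R fact i) \<le> (\<Sum>i. real t ^ i /\<^sub>R fact i)"
    by (intro sum_le_suminf summable_exp_generic) auto
  then have "real t ^ t / fact t \<le> exp (real t)"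
    by (simp add: exp_def divide_inverse mult.commute)
  then show ?thesis by (simp add: divide_le_eq exp_of_nat_mult[symmetric])
qed

lemma choose_le_power:
  assumes "0 < t"
  shows "real (N choose t) \<le> (exp 1 * real N / real t) ^ t"
proof -
  have "real (N choose t) * fact t \<le> real N ^ t"
    using binomial_fact_pow[of N t] by (metis of_nat_fact of_nat_le_iff of_nat_mult of_nat_power)
  then have *: "real (N choose t) * fact t * exp 1 ^ t \<le> real N ^ t * exp 1 ^ t"
    by (intro mult_right_mono) auto
  have "real (N choose t) * real t ^ t \<le> real (N choose t) * (exp 1 ^ t * fact t)"
    by (intro mult_left_mono power_self_le_exp_fact) auto
  also have "\<dots> = real (N choose t) * fact t * exp 1 ^ t" by simp
  also note *
  also have "real N ^ t * exp 1 ^ t = (exp 1 * real N) ^ t" by (simp add: power_mult_distrib)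
  finally have "real (N choose t) * real t ^ t \<le> (exp 1 * real N) ^ t" .
  then show ?thesis using assms by (simp add: power_divide pos_le_divide_eq)
qed

text \<open>
  Let \<open>k = a + 1\<close> and \<open>l = b + 1\<close> be the sides, so that even the smallest rectangle needs
  \<open>a + b + 3 \<ge> 3\<close> closed corners.  Three factors of the power yield the smallness \<open>p\<^sup>3\<close>, at the price
  of a polynomial in the sides; each of the remaining ones is at most \<open>1 / 8\<close>, which outweighs this
  polynomial and leaves a geometric decay in both sides.
\<close>

lemma rectangle_bound:
  fixes p :: real
  assumes p: "0 \<le> p" and m: "exp 1 * p * real m \<le> 1 / 8" and ab: "a + 2 \<le> m" "b + 2 \<le> m"
  shows "real ((a + 2) * (b + 2) choose (a + b + 3)) * p ^ (a + b + 3)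
    \<le> 16 * (exp 1 * p) ^ 3 * ((1 / 2) ^ a * (1 / 2) ^ b)"
proof -
  define e where "e = exp 1 * p"
  \<comment> \<open>The number of corners per closed corner required; it is at most the
    number of points on either side of the rectangle.\<close>
  define r where "r = real ((a + 2) * (b + 2)) / real (a + b + 3)"
  have e: "0 \<le> e" using p by (simp add: e_def)
  have r0: "0 \<le> r" by (simp add: r_def)
  have ra: "r \<le> real (a + 2)" and rb: "r \<le> real (b + 2)"
    by (simp_all add: r_def pos_divide_le_eq field_simps)
  have rm: "r \<le> real m" using ra ab by simp
  have sq: "real (k + 2) ^ 2 \<le> 4 * 4 ^ k" for k
  proof (induction k)
    case (Suc k)
    have "real (Suc k + 2) ^ 2 \<le> 4 * real (k + 2) ^ 2" by (simp add: power2_eq_square field_simps)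
    then show ?case using Suc by simp
  qed simp
  have "real ((a + 2) * (b + 2) choose (a + b + 3)) * p ^ (a + b + 3)
      \<le> (exp 1 * real ((a + 2) * (b + 2)) / real (a + b + 3)) ^ (a + b + 3) * p ^ (a + b + 3)"
    using p by (intro mult_right_mono choose_le_power) auto
  also have "\<dots> = (e * r) ^ (a + b + 3)"
    by (simp add: e_def r_def power_mult_distrib[symmetric] mult_ac)
  also have "\<dots> = e ^ 3 * (r * r * r) * (e * r) ^ (a + b)"
    by (simp add: power_add power_mult_distrib power3_eq_cube)
  also have "\<dots> \<le> e ^ 3 * (real (a + 2) ^ 2 * real (b + 2) ^ 2) * (1 / 8) ^ (a + b)"
  proof -
    have "r * r * r \<le> real (a + 2) * real (b + 2) * real (a + 2)"
      using ra rb r0 by (intro mult_mono) auto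
    also have "\<dots> \<le> real (a + 2) * real (b + 2) * real (a + 2) * real (b + 2)"
      using mult_left_mono[of 1 "real (b + 2)" "real (a + 2) * real (b + 2) * real (a + 2)"] by simp
    finally have "r * r * r \<le> real (a + 2) ^ 2 * real (b + 2) ^ 2"
      by (simp add: power2_eq_square mult_ac)
    then have 1: "e ^ 3 * (r * r * r) \<le> e ^ 3 * (real (a + 2) ^ 2 * real (b + 2) ^ 2)"
      using e by (intro mult_left_mono) auto
    have "e * r \<le> e * real m" using rm e by (rule mult_left_mono)
    also have "\<dots> \<le> 1 / 8" using m by (simp add: e_def)
    finally have 2: "(e * r) ^ (a + b) \<le> (1 / 8) ^ (a + b)"
      using e r0 by (intro power_mono) auto
    show ?thesis by (rule mult_mono[OF 1 2]) (use e r0 in auto)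
  qed
  also have "\<dots> \<le> e ^ 3 * ((4 * 4 ^ a) * (4 * 4 ^ b)) * (1 / 8) ^ (a + b)"
    using e by (intro mult_right_mono mult_left_mono mult_mono sq) auto
  also have "\<dots> = 16 * e ^ 3 * (4 ^ a * (1 / 8) ^ a * (4 ^ b * (1 / 8) ^ b))"
    by (simp add: power_add)
  also have "\<dots> = 16 * e ^ 3 * ((1 / 2) ^ a * (1 / 2) ^ b)"
    unfolding power_mult_distrib[symmetric] by simp
  finally show ?thesis by (simp add: e_def)
qed

text \<open>
  The rectangles are indexed by a corner and the sides \<open>a + 1\<close>, \<open>b + 1\<close>.  There are \<open>(2 n)\<^sup>2\<close> positions
  for given sides, and two of the three factors \<open>p\<close> of \<open>rectangle_bound\<close> absorb this number.
\<close>

lemma prob_not_sparse_le: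
  assumes p: "0 \<le> p" "p \<le> 1" and small: "exp 1 * p * (2 * real n) \<le> 1 / 8"
  shows "measure_pmf.prob (closed_config n p 0)
      {\<omega>. \<not> sparse {1 - int n..int n} (closed_corners n \<omega>)} \<le> exp 1 * p"
proof -
  let ?P = "measure_pmf.prob (closed_config n p 0)"
  let ?W = "{1 - int n..int n}" and ?L = "{..<2 * n - 1}"
  let ?I = "?W \<times> ?W \<times> ?L \<times> ?L"
  let ?S = "\<lambda>(i, j, a, b). {w \<in> diamond n. \<not> even_vertex w \<and> rot w \<in> rect i j (a + 1) (b + 1)}"
  let ?F = "\<lambda>(i, j, a, b). {\<omega>. a + b + 3 \<le> card {w \<in> ?S (i, j, a, b). \<omega> w}}"
  define g :: "nat \<Rightarrow> nat \<Rightarrow> real" where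
    "g a b = 16 * (exp 1 * p) ^ 3 * ((1 / 2) ^ a * (1 / 2) ^ b)" for a b
  have "{\<omega>. \<not> sparse ?W (closed_corners n \<omega>)} \<subseteq> (\<Union>x\<in>?I. ?F x)"
  proof
    fix \<omega> assume "\<omega> \<in> {\<omega>. \<not> sparse ?W (closed_corners n \<omega>)}"
    then obtain i j k l where k: "0 < k" "0 < l" and sub: "rect i j k l \<subseteq> ?W \<times> ?W"
      and crowded: "k + l < card (closed_corners n \<omega> \<inter> rect i j k l)"
      by (auto simp: sparse_def not_le)
    define a b where "a = k - 1" and "b = l - 1"
    have kl: "k = a + 1" "l = b + 1" using k by (auto simp: a_def b_def)
    have "(i, j) \<in> rect i j k l" "(i + int k, j + int l) \<in> rect i j k l"
      by (auto simp: rect_def)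
    then have "(i, j) \<in> ?W \<times> ?W" "(i + int k, j + int l) \<in> ?W \<times> ?W" using sub by blast+
    then have x: "(i, j, a, b) \<in> ?I" using kl by auto
    have fin: "finite (diamond n)" by (rule finite_diamond)
    have "closed_corners n \<omega> \<inter> rect i j k l = rot ` {w \<in> ?S (i, j, a, b). \<omega> w}"
      by (auto simp: closed_corners_def kl)
    then have "card (closed_corners n \<omega> \<inter> rect i j k l) \<le> card {w \<in> ?S (i, j, a, b). \<omega> w}"
      using fin by (simp only:) (intro card_image_le, auto)
    then have "\<omega> \<in> ?F (i, j, a, b)" using crowded kl by simp
    then show "\<omega> \<in> (\<Union>x\<in>?I. ?F x)" using x by blast
  qed
  then have "?P {\<omega>. \<not> sparse ?W (closed_corners n \<omega>)} \<le> ?P (\<Union>x\<in>?I. ?F x)"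
    by (intro measure_pmf.finite_measure_mono) auto
  also have "\<dots> \<le> (\<Sum>x\<in>?I. ?P (?F x))"
    by (intro measure_pmf.finite_measure_subadditive_finite) auto
  also have "\<dots> \<le> (\<Sum>(i, j, a, b)\<in>?I. g a b)"
  proof (rule sum_mono)
    fix x assume "x \<in> ?I"
    then obtain i j a b where x: "x = (i, j, a, b)" and ab: "a \<in> ?L" "b \<in> ?L" by blast
    let ?T = "?S (i, j, a, b)"
    have "?P (?F (i, j, a, b)) \<le> real (card ?T choose (a + b + 3)) * p ^ (a + b + 3)"
      unfolding closed_config_def prod.case
      using p finite_diamond by (intro prob_many_true_le) auto
    also have "\<dots> \<le> real ((a + 2) * (b + 2) choose (a + b + 3)) * p ^ (a + b + 3)"
    proof -
      have "card ?T = card (rot ` ?T)"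
        by (intro card_image[symmetric] inj_onI) (auto elim!: odd_vertexE simp: rot_odd)
      also have "\<dots> \<le> card (rect i j (a + 1) (b + 1))"
        by (intro card_mono) (auto simp: rect_def)
      also have "\<dots> = (a + 2) * (b + 2)" by (simp add: rect_def card_cartesian_product nat_add_distrib)
      finally show ?thesis using p by (intro mult_right_mono) (auto intro: binomial_right_mono)
    qed
    also have "\<dots> \<le> g a b"
      unfolding g_def by (rule rectangle_bound[where m = "2 * n"]) (use p small ab in auto)
    finally show "?P (?F x) \<le> (case x of (i, j, a, b) \<Rightarrow> g a b)" by (simp add: x)
  qed
  also have "\<dots> = (\<Sum>i\<in>?W. \<Sum>j\<in>?W. \<Sum>a\<in>?L. \<Sum>b\<in>?L. g a b)"
    by (simp only: sum.cartesian_product)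
  also have "\<dots> = (2 * real n)\<^sup>2 * (16 * (exp 1 * p) ^ 3 * ((\<Sum>a\<in>?L. (1 / 2) ^ a) * (\<Sum>b\<in>?L. (1 / 2) ^ b)))"
    by (simp add: g_def sum_product sum_distrib_left power2_eq_square mult_ac)
  also have "\<dots> \<le> (2 * real n)\<^sup>2 * (16 * (exp 1 * p) ^ 3 * (2 * 2))"
    using p by (intro mult_left_mono mult_mono) (auto simp: sum_gp_strict sum_nonneg power_le_one)
  also have "\<dots> = 64 * (exp 1 * p) * (exp 1 * p * (2 * real n))\<^sup>2"
    by (simp add: power2_eq_square power3_eq_cube)
  also have "\<dots> \<le> 64 * (exp 1 * p) * (1 / 8)\<^sup>2"
    using p small by (intro mult_left_mono power_mono) auto
  also have "\<dots> = exp 1 * p" by (simp add: power2_eq_square)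
  finally show ?thesis .
qed

section \<open>The limit\<close>

theorem theorem2:
  fixes c :: real and n :: "real \<Rightarrow> nat"
  assumes "c > 0"
    and "\<forall>\<^sub>F p in at_right 0. 0 < n p \<and> real (n p) < c / (p * ln (1 / p))"
  shows "((\<lambda>p. measure_pmf.prob (closed_config (n p) p 0)
            {\<omega>. odin_wins_everywhere (n p) \<omega>}) \<longlongrightarrow> 1) (at_right 0)"
proof (rule tendsto_sandwich)
  let ?P = "\<lambda>p. measure_pmf.prob (closed_config (n p) p 0)"
  have "filterlim (\<lambda>p::real. ln (1 / p)) at_top (at_right 0)"
    using filterlim_compose[OF ln_at_top filterlim_inverse_at_top_right] by (simp add: inverse_eq_divide)
  \<comment> \<open>This factor makes \<open>2 e n p \<le> 1 / 8\<close>.\<close>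
  then have "\<forall>\<^sub>F p in at_right (0::real). 16 * exp 1 * c < ln (1 / p)"
    by (simp add: filterlim_at_top_dense)
  moreover have "\<forall>\<^sub>F p in at_right (0::real). p \<in> {0<..<1}"
    by (rule eventually_at_right_real) simp
  ultimately show "\<forall>\<^sub>F p in at_right 0. 1 - exp 1 * p \<le> ?P p {\<omega>. odin_wins_everywhere (n p) \<omega>}"
    using assms(2)
  proof eventually_elim
    case (elim p)
    let ?A = "{\<omega>. sparse {1 - int (n p)..int (n p)} (closed_corners (n p) \<omega>)}"
    have p: "0 < p" "p < 1" and L: "16 * exp 1 * c < ln (1 / p)" using elim by auto
    have "0 < 16 * exp 1 * c" using assms(1) by simp
    with L have L0: "0 < ln (1 / p)" by linarith
    have "real (n p) * (p * ln (1 / p)) < c"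
      using elim p L0 by (simp add: pos_less_divide_eq)
    then have "16 * exp 1 * (real (n p) * (p * ln (1 / p))) \<le> 16 * exp 1 * c"
      by simp
    also have "\<dots> \<le> 1 * ln (1 / p)" using L by simp
    finally have "(16 * exp 1 * (real (n p) * p)) * ln (1 / p) \<le> 1 * ln (1 / p)"
      by (simp only: mult_ac)
    then have "16 * exp 1 * (real (n p) * p) \<le> 1" using L0 by (simp only: mult_le_cancel_right_pos)
    then have "?P p {\<omega>. \<not> sparse {1 - int (n p)..int (n p)} (closed_corners (n p) \<omega>)} \<le> exp 1 * p"
      using p by (intro prob_not_sparse_le) (auto simp: mult_ac)
    moreover have "{\<omega>. \<not> sparse {1 - int (n p)..int (n p)} (closed_corners (n p) \<omega>)} = UNIV - ?A"
      by auto
    then have "?P p {\<omega>. \<not> sparse {1 - int (n p)..int (n p)} (closed_corners (n p) \<omega>)} = 1 - ?P p ?A"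
      using measure_pmf.prob_compl[of ?A "closed_config (n p) p 0"] by simp
    moreover have "?P p ?A \<le> ?P p {\<omega>. odin_wins_everywhere (n p) \<omega>}"
      using odin_wins_everywhere_if_sparse
      by (intro measure_pmf.finite_measure_mono) auto
    ultimately show ?case by linarith
  qed
  show "\<forall>\<^sub>F p in at_right 0. ?P p {\<omega>. odin_wins_everywhere (n p) \<omega>} \<le> 1"
    by simp
  show "((\<lambda>p. 1 - exp 1 * p) \<longlongrightarrow> (1::real)) (at_right 0)"
    by (rule tendsto_eq_intros refl | simp)+
qed (rule tendsto_const)

end
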